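(* Let $n>1$ be an integer and let $S$ be a semigroup with exactly $n$ minimal left ideals. Then the clique number of the intersection ideal graph satisfies $\omega(\Gamma(S))=n$ if and only if one of the following holds: (i) $S=I_1\cup I_2\cup I_3$, where $I_1,I_2,I_3$ are (three distinct) minimal left ideals of $S$; (ii) $S$ has only two minimal left ideals $I_1$ and $I_2$, and $I_1\cup I_2$ is the unique maximal left ideal of $S$.
   Context: A left ideal of a semigroup $S$ is a non-empty subset $I\subseteq S$ with $SI\subseteq I$; it is nontrivial if $I\neq S$. The intersection of two left ideals is nontrivial if it is non-empty. Minimal and maximal left ideals are understood to be nontrivial: a nontrivial left ideal is minimal if it does not properly contain any left ideal of $S$, and maximal if it is not properly contained in any nontrivial left ideal of $S$. The intersection ideal graph $\Gamma(S)$ is the simple undirected graph whose vertices are the nontrivial left ideals of $S$, with two distinct vertices $I,J$ adjacent if and only if $I\cap J$ is nontrivial. The clique number is the maximum size of a set of pairwise adjacent vertices. *)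

theory Defs
  imports "HOL-Library.Ramsey" "HOL-Library.Extended_Nat"
begin

text \<open>The semigroup \<open>S\<close> is the whole type \<open>'a :: semigroup_mult\<close>, so \<open>S\<close> is written \<open>UNIV\<close>.\<close>

definition left_ideal :: "'a::semigroup_mult set \<Rightarrow> bool" where
  "left_ideal I \<longleftrightarrow> I \<noteq> {} \<and> (\<forall>s. \<forall>x\<in>I. s * x \<in> I)"

definition nontrivial_left_ideal :: "'a::semigroup_mult set \<Rightarrow> bool" where
  "nontrivial_left_ideal I \<longleftrightarrow> left_ideal I \<and> I \<noteq> UNIV"

definition minimal_left_ideal :: "'a::semigroup_mult set \<Rightarrow> bool" where
  "minimal_left_ideal I \<longleftrightarrow> nontrivial_left_ideal I \<and> \<not> (\<exists>J. left_ideal J \<and> J \<subset> I)"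

definition maximal_left_ideal :: "'a::semigroup_mult set \<Rightarrow> bool" where
  "maximal_left_ideal I \<longleftrightarrow>
     nontrivial_left_ideal I \<and> \<not> (\<exists>J. nontrivial_left_ideal J \<and> I \<subset> J)"

text \<open>A simple undirected graph is a pair of its vertex set and its set of two-element edges,
  matching the edge representation used by \<^const>\<open>clique\<close>.\<close>

type_synonym 'v ugraph = "'v set \<times> 'v set set"

definition intersection_ideal_graph :: "'a::semigroup_mult set ugraph" where
  "intersection_ideal_graph =
     ({I. nontrivial_left_ideal I},
      {{I, J} | I J. nontrivial_left_ideal I \<and> nontrivial_left_ideal J \<and> I \<noteq> J \<and> I \<inter> J \<noteq> {}})"

text \<open>The supremum over finite cliques is the maximum if their sizes are bounded, and \<open>\<infinity>\<close>
  otherwise; an infinite clique has finite subcliques of every size.\<close>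

definition clique_number :: "'v ugraph \<Rightarrow> enat" where
  "clique_number G = (SUP C \<in> {C. C \<subseteq> fst G \<and> finite C \<and> clique C (snd G)}. enat (card C))"

end

theory Submission
  imports Defs
begin

text \<open>Distinct minimal left ideals are disjoint, and a left ideal meeting a minimal one contains it.
  All \<open>I \<union> J\<close>, for a fixed minimal \<open>I\<close> and arbitrary minimal \<open>J\<close>, form a clique of size \<open>n\<close> if \<open>n \<ge> 3\<close>;
  the union of three minimal left ideals extends it unless that union is \<open>S\<close>. If it is \<open>S\<close>, the
  vertices fall into three pairs \<open>{I, - I}\<close>, and a clique has at most one member of each. For \<open>n = 2\<close>,
  both \<open>\<omega> = 2\<close> and (ii) say that the vertices are exactly \<open>I\<^sub>1\<close>, \<open>I\<^sub>2\<close> and \<open>I\<^sub>1 \<union> I\<^sub>2\<close>: a further one yields,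
  after adjoining \<open>I\<^sub>1\<close> or \<open>I\<^sub>2\<close> if necessary, a clique of size three and a second maximal left ideal.\<close>

section \<open>Left ideals and minimal left ideals\<close>

lemma left_ideal_Un: "left_ideal I \<Longrightarrow> left_ideal J \<Longrightarrow> left_ideal (I \<union> J)"
  by (auto simp: left_ideal_def)

lemma left_ideal_Int: "left_ideal I \<Longrightarrow> left_ideal J \<Longrightarrow> I \<inter> J \<noteq> {} \<Longrightarrow> left_ideal (I \<inter> J)"
  by (auto simp: left_ideal_def)

lemma left_ideal_nonempty: "left_ideal I \<Longrightarrow> I \<noteq> {}"
  by (auto simp: left_ideal_def)

lemma nontrivial_left_idealI: "left_ideal I \<Longrightarrow> I \<noteq> UNIV \<Longrightarrow> nontrivial_left_ideal I"
  by (simp add: nontrivial_left_ideal_def)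

lemma nontrivial_left_idealD:
  assumes "nontrivial_left_ideal I"
  shows "left_ideal I" and "I \<noteq> UNIV"
  using assms by (auto simp: nontrivial_left_ideal_def)

text \<open>For unions of ideals, properness is certified by a minimal left ideal that the union
  misses.\<close>

lemma nontrivial_left_ideal_if_disjoint:
  assumes "left_ideal I" and "I \<inter> A = {}" and "A \<noteq> {}"
  shows "nontrivial_left_ideal I"
  using assms by (auto simp: nontrivial_left_ideal_def)

lemma minimal_left_idealD:
  assumes "minimal_left_ideal I"
  shows "nontrivial_left_ideal I" and "left_ideal I" and "I \<noteq> {}"
  using assms by (auto simp: minimal_left_ideal_def nontrivial_left_ideal_def left_ideal_def)

text \<open>Minimality of \<open>I\<close> forbids the left ideal \<open>I \<inter> J\<close> from
  being smaller than \<open>I\<close>.\<close>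

lemma minimal_left_ideal_subset:
  assumes "minimal_left_ideal I" and "left_ideal J" and "I \<inter> J \<noteq> {}"
  shows "I \<subseteq> J"
proof -
  have "left_ideal (I \<inter> J)"
    using assms left_ideal_Int minimal_left_idealD(2) by blast
  then have "\<not> I \<inter> J \<subset> I"
    using assms(1) by (auto simp: minimal_left_ideal_def)
  then show ?thesis by blast
qed

lemma minimal_left_ideals_disjoint:
  assumes "minimal_left_ideal I" and "minimal_left_ideal J" and "I \<noteq> J"
  shows "I \<inter> J = {}"
  using assms minimal_left_ideal_subset[of I J] minimal_left_ideal_subset[of J I]
    minimal_left_idealD(2) by blast

text \<open>Each point of \<open>J\<close> lies in some member of \<open>F\<close>; that member
  meets \<open>J\<close>, so by minimality it lies inside \<open>J\<close>. For finite
  \<open>F\<close> this reduces the classification of left ideals to a finite list of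
  unions.\<close>

lemma left_ideal_eq_Union_minimal:
  assumes "\<And>I. I \<in> F \<Longrightarrow> minimal_left_ideal I" and "left_ideal J" and "J \<subseteq> \<Union> F"
  obtains G where "G \<subseteq> F" "J = \<Union> G"
proof
  show "{I \<in> F. I \<subseteq> J} \<subseteq> F" by blast
  have "\<exists>I\<in>F. I \<subseteq> J \<and> x \<in> I" if "x \<in> J" for x
  proof -
    obtain I where I: "I \<in> F" "x \<in> I" using assms(3) \<open>x \<in> J\<close> by blast
    then have "I \<subseteq> J"
      using minimal_left_ideal_subset[OF assms(1)[OF I(1)] assms(2)] \<open>x \<in> J\<close> by blast
    then show ?thesis using I by blast
  qed
  then show "J = \<Union> {I \<in> F. I \<subseteq> J}" by blast
qed

lemma left_ideal_subset_Un2_cases: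
  assumes "minimal_left_ideal I\<^sub>1" "minimal_left_ideal I\<^sub>2"
    and "left_ideal J" "J \<subseteq> I\<^sub>1 \<union> I\<^sub>2"
  shows "J \<in> {I\<^sub>1, I\<^sub>2, I\<^sub>1 \<union> I\<^sub>2}"
proof -
  obtain G where "G \<subseteq> {I\<^sub>1, I\<^sub>2}" "J = \<Union> G"
    by (rule left_ideal_eq_Union_minimal[of "{I\<^sub>1, I\<^sub>2}" J]) (use assms in auto)
  \<comment> \<open>Rewriting \<open>G \<subseteq> {I\<^sub>1, I\<^sub>2}\<close> as membership in a
    power set enumerates four subfamilies; the empty one is excluded since \<open>J\<close> is
    non-empty.\<close>
  then show ?thesis
    using left_ideal_nonempty[OF assms(3)] by (auto simp: Pow_insert simp flip: Pow_iff)
qed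

section \<open>Cliques as intersecting families\<close>

definition intersecting :: "'b set set \<Rightarrow> bool" where
  "intersecting C \<longleftrightarrow> (\<forall>I\<in>C. \<forall>J\<in>C. I \<inter> J \<noteq> {})"

lemma fst_intersection_ideal_graph [simp]:
  "fst intersection_ideal_graph = {I. nontrivial_left_ideal I}"
  by (simp add: intersection_ideal_graph_def)

text \<open>Edges join distinct vertices only, while \<open>intersecting\<close> also tests
  \<open>I = J\<close>; that test succeeds because vertices are non-empty.\<close>

lemma clique_intersection_ideal_graph:
  assumes "C \<subseteq> {I. nontrivial_left_ideal I}"
  shows "clique C (snd intersection_ideal_graph) \<longleftrightarrow> intersecting C"
proof -
  have edge: "{I, J} \<in> snd intersection_ideal_graph \<longleftrightarrow> I \<inter> J \<noteq> {}"
    if "I \<in> C" "J \<in> C" "I \<noteq> J" for I J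
    using that assms by (auto simp: intersection_ideal_graph_def doubleton_eq_iff)
  have "I \<inter> I \<noteq> {}" if "I \<in> C" for I
    using that assms left_ideal_nonempty nontrivial_left_idealD(1) by blast
  then show ?thesis
    unfolding clique_def intersecting_def using edge by metis
qed

lemma clique_number_ge:
  fixes C :: "'a::semigroup_mult set set"
  assumes "finite C" "\<And>I. I \<in> C \<Longrightarrow> nontrivial_left_ideal I" "intersecting C"
  shows "enat (card C) \<le> clique_number (intersection_ideal_graph :: 'a set ugraph)"
  unfolding clique_number_def
  by (rule SUP_upper) (use assms clique_intersection_ideal_graph[of C] in auto)

lemma clique_number_le:
  assumes "\<And>C :: 'a::semigroup_mult set set.
    finite C \<Longrightarrow> (\<And>I. I \<in> C \<Longrightarrow> nontrivial_left_ideal I) \<Longrightarrow> intersecting C \<Longrightarrow> card C \<le> k"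
  shows "clique_number (intersection_ideal_graph :: 'a set ugraph) \<le> enat k"
  unfolding clique_number_def
proof (rule SUP_least)
  fix C :: "'a set set"
  assume C: "C \<in> {C. C \<subseteq> fst intersection_ideal_graph \<and> finite C \<and>
    clique C (snd intersection_ideal_graph)}"
  then have "intersecting C"
    using clique_intersection_ideal_graph[of C] by simp
  then show "enat (card C) \<le> enat k"
    using C assms[of C] by auto
qed

text \<open>Counting device behind the upper bounds: an intersecting family cannot contain two
  distinct disjoint sets.\<close>

lemma intersecting_card_le_one:
  assumes "intersecting C" "C \<subseteq> {A, B}" "A \<inter> B = {}"
  shows "card C \<le> 1"
proof -
  have "C \<subseteq> {A} \<or> C \<subseteq> {B}"
    using assms by (auto simp: intersecting_def)
  then show ?thesis
    using card_mono[of "{A}" C] card_mono[of "{B}" C] by auto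
qed

text \<open>All pairwise intersections contain the non-empty \<open>I\<close>. Strictness of the
  inclusions and \<open>J \<noteq> K\<close> make the three vertices distinct; \<open>J\<close> and
  \<open>K\<close> may be comparable.\<close>

lemma three_le_clique_number:
  fixes I J K :: "'a::semigroup_mult set"
  assumes "nontrivial_left_ideal I" "nontrivial_left_ideal J" "nontrivial_left_ideal K"
    and "I \<subset> J" "I \<subset> K" "J \<noteq> K"
  shows "3 \<le> clique_number (intersection_ideal_graph :: 'a set ugraph)"
proof -
  have "I \<noteq> {}"
    using assms(1) left_ideal_nonempty nontrivial_left_idealD(1) by blast
  then have "intersecting {I, J, K}"
    using assms(4,5) by (auto simp: intersecting_def)
  then have "enat (card {I, J, K}) \<le> clique_number (intersection_ideal_graph :: 'a set ugraph)"
    using assms(1-3) by (intro clique_number_ge) auto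
  moreover have "I \<noteq> J" "I \<noteq> K"
    using assms(4,5) by blast+
  then have "card {I, J, K} = 3"
    using assms(6) by simp
  ultimately show ?thesis by (simp add: numeral_eq_enat)
qed

section \<open>At least three minimal left ideals\<close>

lemma Un3_eq_UNIV_if_clique_number:
  fixes I\<^sub>1 I\<^sub>2 I\<^sub>3 :: "'a::semigroup_mult set"
  assumes fin: "finite {I :: 'a set. minimal_left_ideal I}"
    and \<omega>: "clique_number (intersection_ideal_graph :: 'a set ugraph)
      = enat (card {I :: 'a set. minimal_left_ideal I})"
    and min: "minimal_left_ideal I\<^sub>1" "minimal_left_ideal I\<^sub>2" "minimal_left_ideal I\<^sub>3"
    and ne: "I\<^sub>1 \<noteq> I\<^sub>2" "I\<^sub>1 \<noteq> I\<^sub>3" "I\<^sub>2 \<noteq> I\<^sub>3"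
  shows "UNIV = I\<^sub>1 \<union> I\<^sub>2 \<union> I\<^sub>3"
proof (rule ccontr)
  assume U: "UNIV \<noteq> I\<^sub>1 \<union> I\<^sub>2 \<union> I\<^sub>3"
  let ?M = "{I :: 'a set. minimal_left_ideal I}"
  \<comment> \<open>Every member contains \<open>I\<^sub>1\<close>. The choice
    \<open>J = I\<^sub>1\<close> contributes \<open>I\<^sub>1\<close> itself, so the image has as
    many members as \<open>?M\<close>, and the triple union is one more.\<close>
  let ?C = "insert (I\<^sub>1 \<union> I\<^sub>2 \<union> I\<^sub>3) ((\<union>) I\<^sub>1 ` ?M)"
  note disj = minimal_left_ideals_disjoint and nonempty = minimal_left_idealD(3)
  have "inj_on ((\<union>) I\<^sub>1) ?M"
  proof (rule inj_onI)
    fix J K assume JK: "J \<in> ?M" "K \<in> ?M" "I\<^sub>1 \<union> J = I\<^sub>1 \<union> K"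
    show "J = K"
    proof (rule ccontr)
      assume "J \<noteq> K"
      then have "J \<inter> K = {}" using JK disj by blast
      \<comment> \<open>A point of \<open>J\<close> lies in \<open>I\<^sub>1 \<union> K\<close> but
        not in \<open>K\<close>, and symmetrically for \<open>K\<close>.\<close>
      then have "J \<subseteq> I\<^sub>1" "K \<subseteq> I\<^sub>1" using JK(3) by blast+
      then have "J = I\<^sub>1" "K = I\<^sub>1"
        using JK(1,2) min(1) disj[of J I\<^sub>1] disj[of K I\<^sub>1] nonempty[of J] nonempty[of K] by blast+
      then show False using \<open>J \<noteq> K\<close> by simp
    qed
  qed
  moreover have "I\<^sub>1 \<union> I\<^sub>2 \<union> I\<^sub>3 \<notin> (\<union>) I\<^sub>1 ` ?M"
  proof
    assume "I\<^sub>1 \<union> I\<^sub>2 \<union> I\<^sub>3 \<in> (\<union>) I\<^sub>1 ` ?M"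
    then obtain J where J: "minimal_left_ideal J" "I\<^sub>1 \<union> I\<^sub>2 \<union> I\<^sub>3 = I\<^sub>1 \<union> J" by blast
    \<comment> \<open>Both \<open>I\<^sub>2\<close> and \<open>I\<^sub>3\<close> miss
      \<open>I\<^sub>1\<close>, so \<open>J\<close> alone would have to absorb them.\<close>
    have "I\<^sub>2 \<subseteq> J" "I\<^sub>3 \<subseteq> J"
      using J(2) disj[OF min(1,2) ne(1)] disj[OF min(1,3) ne(2)] by blast+
    then have "I\<^sub>2 = J" "I\<^sub>3 = J"
      using disj[OF min(2) J(1)] disj[OF min(3) J(1)] nonempty[OF min(2)] nonempty[OF min(3)]
      by blast+
    then show False using ne(3) by simp
  qed
  ultimately have card: "card ?C = Suc (card ?M)"
    using fin by (simp add: card_image)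
  have "nontrivial_left_ideal K" if "K \<in> ?C" for K
  proof (rule nontrivial_left_idealI)
    show "left_ideal K"
      using that min minimal_left_idealD(2) left_ideal_Un by blast
    from that consider "K = I\<^sub>1 \<union> I\<^sub>2 \<union> I\<^sub>3"
      | J where "minimal_left_ideal J" "K = I\<^sub>1 \<union> J"
      by blast
    then show "K \<noteq> UNIV"
    proof cases
      case 2
      \<comment> \<open>One of the three given ideals differs from both \<open>I\<^sub>1\<close> and
        \<open>J\<close>; it is disjoint from \<open>K\<close> and witnesses that \<open>K\<close>
        is proper.\<close>
      have "\<exists>L. minimal_left_ideal L \<and> L \<noteq> I\<^sub>1 \<and> L \<noteq> J"
        using min ne by metis
      then obtain L where L: "minimal_left_ideal L" "L \<noteq> I\<^sub>1" "L \<noteq> J" by blast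
      then have "L \<inter> K = {}"
        using 2 disj[OF L(1) min(1)] disj[OF L(1) 2(1)] by blast
      then show ?thesis using nonempty[OF L(1)] by blast
    qed (use U in blast)
  qed
  moreover have "intersecting ?C"
    using nonempty[OF min(1)] by (auto simp: intersecting_def)
  ultimately have "enat (Suc (card ?M)) \<le> enat (card ?M)"
    using clique_number_ge[of ?C] fin unfolding card \<omega> by blast
  then show False by simp
qed

text \<open>A fourth minimal left ideal would be disjoint from three sets covering S. This fixes the
  number of minimal left ideals in case (i).\<close>

lemma minimal_left_ideals_if_Un3_eq_UNIV:
  assumes "minimal_left_ideal I\<^sub>1" "minimal_left_ideal I\<^sub>2" "minimal_left_ideal I\<^sub>3"
    and "UNIV = I\<^sub>1 \<union> I\<^sub>2 \<union> I\<^sub>3"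
  shows "{I. minimal_left_ideal I} = {I\<^sub>1, I\<^sub>2, I\<^sub>3}"
proof -
  have "I \<in> {I\<^sub>1, I\<^sub>2, I\<^sub>3}" if I: "minimal_left_ideal I" for I
  proof (rule ccontr)
    assume "I \<notin> {I\<^sub>1, I\<^sub>2, I\<^sub>3}"
    then have "I \<inter> I\<^sub>1 = {}" "I \<inter> I\<^sub>2 = {}" "I \<inter> I\<^sub>3 = {}"
      using assms(1-3)[THEN minimal_left_ideals_disjoint[OF I]] by simp_all
    then show False using assms(4) minimal_left_idealD(3)[OF I] by blast
  qed
  then show ?thesis using assms by blast
qed

lemma clique_number_if_Un3_eq_UNIV:
  fixes I\<^sub>1 I\<^sub>2 I\<^sub>3 :: "'a::semigroup_mult set"
  assumes min: "minimal_left_ideal I\<^sub>1" "minimal_left_ideal I\<^sub>2" "minimal_left_ideal I\<^sub>3"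
    and ne: "I\<^sub>1 \<noteq> I\<^sub>2" "I\<^sub>1 \<noteq> I\<^sub>3" "I\<^sub>2 \<noteq> I\<^sub>3"
    and U: "UNIV = I\<^sub>1 \<union> I\<^sub>2 \<union> I\<^sub>3"
  shows "clique_number (intersection_ideal_graph :: 'a set ugraph) = 3"
proof (rule antisym)
  note disj = minimal_left_ideals_disjoint[OF min(1,2) ne(1)]
    minimal_left_ideals_disjoint[OF min(1,3) ne(2)] minimal_left_ideals_disjoint[OF min(2,3) ne(3)]
  note nonempty = min[THEN minimal_left_idealD(3)] and li = min[THEN minimal_left_idealD(2)]
  have cover: "x \<in> I\<^sub>1 \<or> x \<in> I\<^sub>2 \<or> x \<in> I\<^sub>3" for x
    using U by (metis UNIV_I Un_iff)
  have compl: "- I\<^sub>1 = I\<^sub>2 \<union> I\<^sub>3" "- I\<^sub>2 = I\<^sub>1 \<union> I\<^sub>3" "- I\<^sub>3 = I\<^sub>1 \<union> I\<^sub>2"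
    using cover disj by blast+
  \<comment> \<open>Lower bound: the clique consists of \<open>I\<^sub>1\<close>,
    \<open>I\<^sub>1 \<union> I\<^sub>2\<close> and
    \<open>I\<^sub>1 \<union> I\<^sub>3\<close>.\<close>
  have "(I\<^sub>1 \<union> I\<^sub>2) \<inter> I\<^sub>3 = {}" "(I\<^sub>1 \<union> I\<^sub>3) \<inter> I\<^sub>2 = {}"
    using disj by blast+
  then have "nontrivial_left_ideal (I\<^sub>1 \<union> I\<^sub>2)" "nontrivial_left_ideal (I\<^sub>1 \<union> I\<^sub>3)"
    using li nonempty left_ideal_Un nontrivial_left_ideal_if_disjoint by metis+
  moreover have "I\<^sub>1 \<subset> I\<^sub>1 \<union> I\<^sub>2" "I\<^sub>1 \<subset> I\<^sub>1 \<union> I\<^sub>3" "I\<^sub>1 \<union> I\<^sub>2 \<noteq> I\<^sub>1 \<union> I\<^sub>3"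
    using nonempty disj by blast+
  ultimately show "3 \<le> clique_number (intersection_ideal_graph :: 'a set ugraph)"
    using three_le_clique_number minimal_left_idealD(1)[OF min(1)] by blast
  have "clique_number (intersection_ideal_graph :: 'a set ugraph) \<le> enat 3"
  proof (rule clique_number_le)
    fix C :: "'a set set"
    assume C: "finite C" "\<And>I. I \<in> C \<Longrightarrow> nontrivial_left_ideal I" "intersecting C"
    \<comment> \<open>The part of the clique lying in one complementary pair; three such parts will
      cover \<open>C\<close>.\<close>
    let ?P = "\<lambda>I. C \<inter> {I, - I}"
    have one: "card (?P I) \<le> 1" for I
      using C(3) by (intro intersecting_card_le_one[of _ I "- I"]) (auto simp: intersecting_def)
    have "C \<subseteq> ?P I\<^sub>1 \<union> ?P I\<^sub>2 \<union> ?P I\<^sub>3"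
    proof
      fix J assume J: "J \<in> C"
      then have nt: "left_ideal J" "J \<noteq> UNIV"
        using C(2) nontrivial_left_idealD by blast+
      have "J \<subseteq> \<Union> {I\<^sub>1, I\<^sub>2, I\<^sub>3}"
        using cover by auto
      then obtain G where "G \<subseteq> {I\<^sub>1, I\<^sub>2, I\<^sub>3}" "J = \<Union> G"
        by (rule left_ideal_eq_Union_minimal[rotated 2]) (use min nt(1) in auto)
      \<comment> \<open>Expanding the power set gives eight unions; removing the empty and the full
        one leaves the six candidates, which \<open>compl\<close> groups into pairs.\<close>
      then have "J \<in> \<Union> ` Pow {I\<^sub>1, I\<^sub>2, I\<^sub>3}"
        by blast
      moreover have "J \<noteq> {}" "J \<noteq> I\<^sub>1 \<union> I\<^sub>2 \<union> I\<^sub>3"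
        using left_ideal_nonempty nt U by auto
      ultimately have "J \<in> {I\<^sub>1, I\<^sub>2, I\<^sub>3, I\<^sub>2 \<union> I\<^sub>3, I\<^sub>1 \<union> I\<^sub>3, I\<^sub>1 \<union> I\<^sub>2}"
        by (simp only: Pow_insert Pow_empty image_Un image_insert image_empty Sup_insert Sup_empty
            sup_bot_right Un_insert_left Un_empty_left insert_iff empty_iff Un_assoc) argo
      then show "J \<in> ?P I\<^sub>1 \<union> ?P I\<^sub>2 \<union> ?P I\<^sub>3"
        using J compl by auto
    qed
    then have "card C \<le> card (?P I\<^sub>1 \<union> ?P I\<^sub>2 \<union> ?P I\<^sub>3)"
      using C(1) by (intro card_mono) auto
    also have "\<dots> \<le> card (?P I\<^sub>1) + card (?P I\<^sub>2) + card (?P I\<^sub>3)"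
      using card_Un_le[of "?P I\<^sub>1 \<union> ?P I\<^sub>2" "?P I\<^sub>3"] card_Un_le[of "?P I\<^sub>1" "?P I\<^sub>2"] by linarith
    also have "\<dots> \<le> 3"
      using one[of I\<^sub>1] one[of I\<^sub>2] one[of I\<^sub>3] by linarith
    finally show "card C \<le> 3" .
  qed
  then show "clique_number (intersection_ideal_graph :: 'a set ugraph) \<le> 3"
    by (simp add: numeral_eq_enat)
qed

section \<open>Exactly two minimal left ideals, or a given pair of them\<close>

lemma Un2_unique_maximal_if_clique_number:
  fixes I\<^sub>1 I\<^sub>2 :: "'a::semigroup_mult set"
  assumes min: "minimal_left_ideal I\<^sub>1" "minimal_left_ideal I\<^sub>2" and ne: "I\<^sub>1 \<noteq> I\<^sub>2"
    and \<omega>: "clique_number (intersection_ideal_graph :: 'a set ugraph) = 2"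
  shows "{M. maximal_left_ideal M} = {I\<^sub>1 \<union> I\<^sub>2}"
proof -
  let ?M = "I\<^sub>1 \<union> I\<^sub>2"
  note disj = minimal_left_ideals_disjoint[OF min ne]
  note nonempty = min[THEN minimal_left_idealD(3)] and li = min[THEN minimal_left_idealD(2)]
    and nt = min[THEN minimal_left_idealD(1)]
  have no3: False
    if "nontrivial_left_ideal I" "nontrivial_left_ideal J" "nontrivial_left_ideal K"
      "I \<subset> J" "I \<subset> K" "J \<noteq> K" for I J K :: "'a set"
    using three_le_clique_number[OF that] unfolding \<omega> by simp
  \<comment> \<open>Otherwise every vertex is \<open>I\<^sub>1\<close> or \<open>I\<^sub>2\<close>;
    these are not adjacent, so the clique number would be at most 1.\<close>
  have "?M \<noteq> UNIV"
  proof
    assume U: "?M = UNIV"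
    have "clique_number (intersection_ideal_graph :: 'a set ugraph) \<le> enat 1"
    proof (rule clique_number_le)
      fix C :: "'a set set"
      assume C: "\<And>I. I \<in> C \<Longrightarrow> nontrivial_left_ideal I" "intersecting C"
      have "C \<subseteq> {I\<^sub>1, I\<^sub>2}"
        using C(1) left_ideal_subset_Un2_cases[OF min] U nontrivial_left_idealD by blast
      then show "card C \<le> 1"
        by (rule intersecting_card_le_one[OF C(2) _ disj])
    qed
    then show False using \<omega> by (simp add: numeral_eq_enat)
  qed
  then have M: "nontrivial_left_ideal ?M"
    using li by (auto intro!: nontrivial_left_idealI left_ideal_Un)
  have sub: "I\<^sub>1 \<subset> ?M" "I\<^sub>2 \<subset> ?M" using nonempty disj by blast+
  \<comment> \<open>A counterexample forms a clique of size three with \<open>?M\<close> and the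
    minimal left ideal that it contains.\<close>
  have contain: "J \<subseteq> ?M" if J: "nontrivial_left_ideal J" and meet: "I\<^sub>1 \<subseteq> J \<or> I\<^sub>2 \<subseteq> J" for J
  proof (rule ccontr)
    assume "\<not> J \<subseteq> ?M"
    then have "I\<^sub>1 \<subset> J \<or> I\<^sub>2 \<subset> J" "J \<noteq> ?M" using meet by blast+
    then show False
      using no3[OF nt(1) M J] no3[OF nt(2) M J] sub by blast
  qed
  have all: "J \<subseteq> ?M" if J: "nontrivial_left_ideal J" for J
  proof (cases "I\<^sub>1 \<subseteq> J")
    case False
    then have "I\<^sub>1 \<inter> J = {}"
      using J minimal_left_ideal_subset[OF min(1)] nontrivial_left_idealD(1) by blast
    show ?thesis
    proof (cases "I\<^sub>2 \<subseteq> J")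
      case False
      \<comment> \<open>Here \<open>J\<close> contains neither minimal left ideal. Adjoining
        \<open>I\<^sub>2\<close> keeps it disjoint from \<open>I\<^sub>1\<close>, hence proper, so
        that \<open>contain\<close> applies.\<close>
      have "left_ideal (I\<^sub>2 \<union> J)"
        using left_ideal_Un[OF li(2) nontrivial_left_idealD(1)[OF J]] .
      moreover have "(I\<^sub>2 \<union> J) \<inter> I\<^sub>1 = {}" using disj \<open>I\<^sub>1 \<inter> J = {}\<close> by blast
      ultimately have "nontrivial_left_ideal (I\<^sub>2 \<union> J)"
        using nonempty(1) by (rule nontrivial_left_ideal_if_disjoint)
      then show ?thesis using contain[of "I\<^sub>2 \<union> J"] by blast
    qed (use contain J in blast)
  qed (use contain J in blast)
  have "maximal_left_ideal ?M"
    using M all by (auto simp: maximal_left_ideal_def)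
  moreover have "J = ?M" if J: "maximal_left_ideal J" for J
    using J M all[of J] by (auto simp: maximal_left_ideal_def)
  ultimately show ?thesis by blast
qed

lemma clique_number_if_Un2_unique_maximal:
  fixes I\<^sub>1 I\<^sub>2 :: "'a::semigroup_mult set"
  assumes min: "minimal_left_ideal I\<^sub>1" "minimal_left_ideal I\<^sub>2" and ne: "I\<^sub>1 \<noteq> I\<^sub>2"
    and uniq: "{M. maximal_left_ideal M} = {I\<^sub>1 \<union> I\<^sub>2}"
  shows "clique_number (intersection_ideal_graph :: 'a set ugraph) = 2"
proof (rule antisym)
  let ?M = "I\<^sub>1 \<union> I\<^sub>2"
  note disj = minimal_left_ideals_disjoint[OF min ne]
  note nonempty = min[THEN minimal_left_idealD(3)] and li = min[THEN minimal_left_idealD(2)]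
    and nt = min[THEN minimal_left_idealD(1)]
  have max: "maximal_left_ideal ?M" using uniq by blast
  then have M: "nontrivial_left_ideal ?M" by (simp add: maximal_left_ideal_def)
  \<comment> \<open>Otherwise \<open>J \<union> ?M\<close> would be a vertex strictly above the
    maximal \<open>?M\<close>.\<close>
  have out: "J \<union> ?M = UNIV" if "left_ideal J" "\<not> J \<subseteq> ?M" for J
  proof (rule ccontr)
    assume "J \<union> ?M \<noteq> UNIV"
    then have "nontrivial_left_ideal (J \<union> ?M)"
      using that(1) M nontrivial_left_idealD(1) nontrivial_left_idealI left_ideal_Un by blast
    moreover have "?M \<subset> J \<union> ?M" using that(2) by blast
    ultimately show False using max by (auto simp: maximal_left_ideal_def)
  qed
  \<comment> \<open>A counterexample \<open>J\<close> would be the complement of \<open>B\<close>, hence a second maximal left ideal.\<close>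
  have contain: "J \<subseteq> A \<union> B"
    if AB: "minimal_left_ideal A" "minimal_left_ideal B" "A \<union> B = ?M"
      and J: "nontrivial_left_ideal J" "A \<subseteq> J" for A B J
  proof (rule ccontr)
    assume "\<not> J \<subseteq> A \<union> B"
    then have J': "\<not> J \<subseteq> ?M" using AB(3) by simp
    have "\<not> (\<exists>K. nontrivial_left_ideal K \<and> J \<subset> K)"
    proof
      assume "\<exists>K. nontrivial_left_ideal K \<and> J \<subset> K"
      then obtain K where K: "nontrivial_left_ideal K" "J \<subset> K" by blast
      \<comment> \<open>Since \<open>A \<subseteq> J\<close>, only points of \<open>B\<close> can be
        missing from \<open>J\<close>. A strictly larger \<open>K\<close> therefore meets
        \<open>B\<close>, contains it by minimality, and is all of S.\<close>
      have "J \<union> ?M = UNIV" using J' J(1) out nontrivial_left_idealD(1) by blast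
      then have U: "J \<union> B = UNIV" using J(2) AB(3) by blast
      then have "B \<inter> K \<noteq> {}" using K(2) by blast
      then have "B \<subseteq> K"
        using minimal_left_ideal_subset[OF AB(2)] K(1) nontrivial_left_idealD(1) by blast
      then show False using U K nontrivial_left_idealD(2) by blast
    qed
    then have "maximal_left_ideal J" using J(1) by (simp add: maximal_left_ideal_def)
    then have "J = ?M" using uniq by blast
    then show False using J' by blast
  qed
  have all: "J \<subseteq> ?M" if J: "nontrivial_left_ideal J" for J
  proof (cases "I\<^sub>1 \<subseteq> J")
    case True
    then show ?thesis using contain[OF min _ J] by blast
  next
    case False
    then have "I\<^sub>1 \<inter> J = {}"
      using J minimal_left_ideal_subset[OF min(1)] nontrivial_left_idealD(1) by blast
    \<comment> \<open>Being disjoint from \<open>I\<^sub>1\<close>, the union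
      \<open>I\<^sub>2 \<union> J\<close> is a vertex, and \<open>contain\<close> applies with the
      two minimal left ideals exchanged.\<close>
    then have "(I\<^sub>2 \<union> J) \<inter> I\<^sub>1 = {}" using disj by blast
    moreover have "left_ideal (I\<^sub>2 \<union> J)"
      using left_ideal_Un[OF li(2) nontrivial_left_idealD(1)[OF J]] .
    ultimately have "nontrivial_left_ideal (I\<^sub>2 \<union> J)"
      using nonempty(1) nontrivial_left_ideal_if_disjoint by blast
    then show ?thesis using contain[OF min(2,1), of "I\<^sub>2 \<union> J"] by blast
  qed
  have "clique_number (intersection_ideal_graph :: 'a set ugraph) \<le> enat 2"
  proof (rule clique_number_le)
    fix C :: "'a set set"
    assume C: "finite C" "\<And>I. I \<in> C \<Longrightarrow> nontrivial_left_ideal I" "intersecting C"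
    have "C \<subseteq> {I\<^sub>1, I\<^sub>2, ?M}"
      using C(2) left_ideal_subset_Un2_cases[OF min] all nontrivial_left_idealD(1) by blast
    \<comment> \<open>Apart from \<open>?M\<close>, a clique can use only one of the disjoint
      \<open>I\<^sub>1\<close> and \<open>I\<^sub>2\<close>.\<close>
    then have "C - {?M} \<subseteq> {I\<^sub>1, I\<^sub>2}" by blast
    moreover have "intersecting (C - {?M})" using C(3) by (auto simp: intersecting_def)
    ultimately have "card (C - {?M}) \<le> 1"
      using intersecting_card_le_one[OF _ _ disj] by simp
    then show "card C \<le> 2"
      using C(1) by (cases "?M \<in> C") (auto simp: card_Diff_singleton)
  qed
  then show "clique_number (intersection_ideal_graph :: 'a set ugraph) \<le> 2"
    by (simp add: numeral_eq_enat)
  have "I\<^sub>1 \<noteq> ?M" using disj nonempty by blast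
  then have "card {I\<^sub>1, ?M} = 2" by simp
  moreover have "enat (card {I\<^sub>1, ?M}) \<le> clique_number (intersection_ideal_graph :: 'a set ugraph)"
    using nt M nonempty by (intro clique_number_ge) (auto simp: intersecting_def)
  ultimately show "2 \<le> clique_number (intersection_ideal_graph :: 'a set ugraph)"
    by (simp add: numeral_eq_enat)
qed

theorem theorem4p8:
  fixes n :: nat
  assumes "n > 1"
    and "finite {I :: 'a::semigroup_mult set. minimal_left_ideal I}"
    and "card {I :: 'a set. minimal_left_ideal I} = n"
  shows "clique_number (intersection_ideal_graph :: 'a set ugraph) = enat n \<longleftrightarrow>
    (\<exists>I\<^sub>1 I\<^sub>2 I\<^sub>3 :: 'a set.
        minimal_left_ideal I\<^sub>1 \<and> minimal_left_ideal I\<^sub>2 \<and> minimal_left_ideal I\<^sub>3 \<and>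
        I\<^sub>1 \<noteq> I\<^sub>2 \<and> I\<^sub>1 \<noteq> I\<^sub>3 \<and> I\<^sub>2 \<noteq> I\<^sub>3 \<and>
        (UNIV :: 'a set) = I\<^sub>1 \<union> I\<^sub>2 \<union> I\<^sub>3) \<or>
    (\<exists>I\<^sub>1 I\<^sub>2 :: 'a set.
        I\<^sub>1 \<noteq> I\<^sub>2 \<and> {I. minimal_left_ideal I} = {I\<^sub>1, I\<^sub>2} \<and>
        {M. maximal_left_ideal M} = {I\<^sub>1 \<union> I\<^sub>2})"
    (is "?\<omega> = enat n \<longleftrightarrow> ?i \<or> ?ii")
proof
  let ?M = "{I :: 'a set. minimal_left_ideal I}"
  assume \<omega>: "?\<omega> = enat n"
  show "?i \<or> ?ii"
  \<comment> \<open>The case \<open>n = 2\<close> leads to (ii); for larger \<open>n\<close>, any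
    three of the minimal left ideals give (i).\<close>
  proof (cases "n = 2")
    case True
    then obtain I\<^sub>1 I\<^sub>2 where I: "?M = {I\<^sub>1, I\<^sub>2}" "I\<^sub>1 \<noteq> I\<^sub>2"
      using assms(3) by (auto simp: card_2_iff)
    then have "minimal_left_ideal I\<^sub>1" "minimal_left_ideal I\<^sub>2" by blast+
    then have "{M. maximal_left_ideal M} = {I\<^sub>1 \<union> I\<^sub>2}"
      using Un2_unique_maximal_if_clique_number I(2) \<omega> True by (simp add: numeral_eq_enat)
    with I have ?ii by (intro exI conjI)
    then show ?thesis ..
  next
    case False
    then have "3 \<le> card ?M" using assms(1,3) by simp
    then obtain T where T: "T \<subseteq> ?M" "card T = 3"
      by (meson obtain_subset_with_card_n)
    then obtain I\<^sub>1 I\<^sub>2 I\<^sub>3 where I: "T = {I\<^sub>1, I\<^sub>2, I\<^sub>3}" "I\<^sub>1 \<noteq> I\<^sub>2" "I\<^sub>1 \<noteq> I\<^sub>3" "I\<^sub>2 \<noteq> I\<^sub>3"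
      by (auto simp: card_3_iff)
    then have min: "minimal_left_ideal I\<^sub>1" "minimal_left_ideal I\<^sub>2" "minimal_left_ideal I\<^sub>3"
      using T(1) by blast+
    have "UNIV = I\<^sub>1 \<union> I\<^sub>2 \<union> I\<^sub>3"
      using Un3_eq_UNIV_if_clique_number[OF assms(2) _ min I(2-4)] \<omega> assms(3) by simp
    then show ?thesis using min I(2-4) by blast
  qed
next
  assume "?i \<or> ?ii"
  then show "?\<omega> = enat n"
  proof (elim disjE exE conjE)
    fix I\<^sub>1 I\<^sub>2 I\<^sub>3 :: "'a set"
    assume min: "minimal_left_ideal I\<^sub>1" "minimal_left_ideal I\<^sub>2" "minimal_left_ideal I\<^sub>3"
      and ne: "I\<^sub>1 \<noteq> I\<^sub>2" "I\<^sub>1 \<noteq> I\<^sub>3" "I\<^sub>2 \<noteq> I\<^sub>3" and U: "UNIV = I\<^sub>1 \<union> I\<^sub>2 \<union> I\<^sub>3"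
    \<comment> \<open>The covering determines \<open>n\<close>, so the clique number 3 computed from
      it is indeed \<open>n\<close>.\<close>
    have "n = 3"
      using minimal_left_ideals_if_Un3_eq_UNIV[OF min U] ne assms(3) by simp
    then show ?thesis
      using clique_number_if_Un3_eq_UNIV[OF min ne U] by (simp add: numeral_eq_enat)
  next
    fix I\<^sub>1 I\<^sub>2 :: "'a set"
    assume I: "I\<^sub>1 \<noteq> I\<^sub>2" "{I. minimal_left_ideal I} = {I\<^sub>1, I\<^sub>2}" "{M. maximal_left_ideal M} = {I\<^sub>1 \<union> I\<^sub>2}"
    then have "minimal_left_ideal I\<^sub>1" "minimal_left_ideal I\<^sub>2" by blast+
    moreover have "n = 2" using I(1,2) assms(3) by simp
    ultimately show ?thesis
      using clique_number_if_Un2_unique_maximal I(1,3) by (simp add: numeral_eq_enat)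
  qed
qed

end
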